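(* Fix $\alpha>0$ and $\alpha_q>0$. Assume $\Omega'\subset\subset\Omega$ and $W\subset\Omega_R$ with $\operatorname{dist}(W,\Omega)=d_0>0$. In addition: (1) Let $u_0^\alpha\in\widetilde H^s(\Omega)$ be the unique minimizer of $J_\alpha^\delta(v)=\|\mathcal Lv-\mu^\delta\|_{L^2(W)}^2+\alpha\|v\|_{H^s(\mathbb{R}^d)}^2$ over $\widetilde H^s(\Omega)$, let $u^\alpha=\bar u_f+u_0^\alpha$, and let $w^\alpha=((-\Delta)^su^\alpha)|_{\Omega'}$, assumed to belong to $L^2(\Omega')$ with $\|w^\alpha\|_{L^2(\Omega')}\le M_w$. Let $q^\alpha\in L^2(\Omega')$ be the unique minimizer over $p\in L^2(\Omega')$ of $\|w^\alpha+p\,u^\alpha\|_{L^2(\Omega')}^2+\alpha_q\|p\|_{L^2(\Omega')}^2$. (2) Let $u_h^\alpha\in V_h$ and $w_h^\alpha\in V_{h,0}$ be the discrete state and interior fractional Laplacian reconstructions (defined in the context), and let $q_h^\alpha\in Q_h$ be the unique minimizer over $q_h\in Q_h$ of $\|w_h^\alpha+q_hu_h^\alpha\|_{L^2(\Omega')}^2+\alpha_q\|q_h\|_{L^2(\Omega')}^2$. (3) Assume there exists $\kappa_0>0$ such that $|u^\alpha(x)|\ge\kappa_0$ for a.e. $x\in\Omega'$. Define \[ E_u(h,\alpha):=\|u_h^\alpha-u^\alpha\|_{L^\infty(\Omega')},\qquad E_w(h,\alpha):=\|w_h^\alpha-w^\alpha\|_{L^2(\Omega')}, \] and assume $E_u(h,\alpha)\le\kappa_0/2$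 (then $|u_h^\alpha|\ge\kappa_0/2$ a.e. on $\Omega'$). (4) Assume $q^\alpha\in H^m(\Omega')$ for some $0<m\le r+1$, where $r$ is the polynomial degree of $Q_h$, and let $I_h^Q:H^m(\Omega')\to Q_h$ be an approximation operator with $\|p-I_h^Qp\|_{L^2(\Omega')}\le Ch^m\|p\|_{H^m(\Omega')}$ and $\|I_h^Qp\|_{L^2(\Omega')}\le C\|p\|_{L^2(\Omega')}$ for all $p\in H^m(\Omega')$, with $C$ independent of $h$. Then there exists a constant $C>0$ independent of $h$ (but possibly depending on $\|u^\alpha\|_{L^\infty(\Omega')}$, $\|w^\alpha\|_{L^2(\Omega')}$, $\alpha_q$, and $\Omega'$) such that \[ \|q_h^\alpha-q^\alpha\|_{L^2(\Omega')}\le\frac{C}{\kappa_0^2}\Big(E_w(h,\alpha)+E_u(h,\alpha)+h^m\|q^\alpha\|_{H^m(\Omega')}\Big). \]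
   Context: Continuous setting. $d\ge1$, $s\in(0,1)$, $\epsilon>0$; $\Omega\subset\mathbb{R}^d$ is a bounded Lipschitz polygonal/polyhedral domain, $\Omega_e=\mathbb{R}^d\setminus\overline\Omega$; $W\subset\subset\Omega_e$ is a nonempty bounded open set. $(-\Delta)^s u(x)=c_{d,s}\,\mathrm{P.V.}\int_{\mathbb{R}^d}\frac{u(x)-u(y)}{|x-y|^{d+2s}}dy$ with a normalization constant $c_{d,s}>0$ (understood distributionally in general). For open $U$, $\widetilde H^t(U)$ is the closure of $C_c^\infty(U)$ in $H^t(\mathbb{R}^d)$. The exterior datum is $f\in C_c^\infty(W)$, $f\in\widetilde H^{s+\epsilon}(W)\setminus\{0\}$, with zero extension $\bar u_f$; the potential is $q\in L^\infty(\Omega)$ with $\operatorname{supp}(q)\subset\Omega'$. For $v\in L^2(\Omega)$ (extended by zero) and $x\in\overline W$, $(\mathcal Lv)(x)=-c_{d,s}\int_\Omega\frac{v(y)}{|x-y|^{d+2s}}dy$. $\mu^\delta\in L^2(W)$ is the noisy preprocessed measurement, i.e. a noisy version of $\mu=\mathcal L(u-\bar u_f)$, $u$ being the weak solution of $(-\Delta)^su+qu=0$ in $\Omega$, $u=f$ in $\Omega_e$. It is understood that $u^\alpha\in L^\infty(\Omega')$. Discrete setting. $\Omega_R=(-R,R)^d\supset\Omega\cup W$. $\mathcal T_h$ is a quasi-uniform mesh of $\Omega_R$ of size $h$ fitted to $\Omega$; $V_h\subset H^1(\Omega_R)$ is the continuous piecewise polynomial finite element space of degree $p\ge1$; $V_{h,0}=\{v_h\in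 V_h:v_h=0\text{ on }\Omega_R\setminus\Omega\}$; $u_{h,f}=I_h\bar u_f\in V_h$ is the nodal interpolant. $\mathcal T_h^W$ is a shape-regular mesh of $W$, $S_h^W\subset C(\overline W)$ the continuous piecewise polynomial space on it with nodal basis $\{\vartheta_k\}_{k=1}^{N_W}$ and nodes $x_k\in\overline W$; $\mathbf W_{ij}=\int_W\vartheta_i\vartheta_j\,dx$; $Y=\mathbb{R}^{N_W}$ with $\|y\|_Y^2=y^\top\mathbf Wy$; $\psi_W=(\psi(x_k))_k$ for continuous $\psi$. $\mu_W^\delta=(g^\delta(x_k)-(\mathcal L_{h,R}u_{h,f})_k)_k\in Y$, where $g^\delta$ is the noisy measurement of $((-\Delta)^su)|_W$ and $(\mathcal L_{h,R}v)_k=c_{d,s}\,\mathrm{P.V.}\int_{\Omega_R}\frac{v(x_k)-v(y)}{|x_k-y|^{d+2s}}dy$. Let $a_R(u,v)=\frac{c_{d,s}}{2}\iint_{\Omega_R\times\Omega_R}\frac{(u(x)-u(y))(v(x)-v(y))}{|x-y|^{d+2s}}dxdy+c_{d,s}\int_{\Omega_R}u(x)v(x)\big(\int_{\mathbb{R}^d\setminus\Omega_R}\frac{dy}{|x-y|^{d+2s}}\big)dx$. Then $u_{0,h}^\alpha\in V_{h,0}$ is the unique minimizer over $v_h\in V_{h,0}$ of $\|(\mathcal Lv_h)_W-\mu_W^\delta\|_Y^2+\alpha\big(a_R(v_h,v_h)+\|v_h\|_{L^2(\Omega_R)}^2\big)$, $u_h^\alpha=u_{h,f}+u_{0,h}^\alpha$,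 and $w_h^\alpha\in V_{h,0}$ is defined by $(w_h^\alpha,\varphi_h)_{L^2(\Omega)}=a_R(u_h^\alpha,\varphi_h)$ for all $\varphi_h\in V_{h,0}$. $Q_h\subset L^\infty(\Omega')\cap L^2(\Omega')$ is a finite element space of (globally discontinuous) elementwise polynomials of degree $r$ on $\Omega'$. *)

theory Defs
  imports "HOL-Analysis.Analysis" "HOL-Probability.Essential_Supremum"
begin

text \<open>Elements of the function spaces below are representatives: functions on the whole type
  whose values outside the set in question are irrelevant, and which are identified only up to
  null sets.\<close>

definition L2 :: "(real^'n) set \<Rightarrow> (real^'n \<Rightarrow> real) set" where
  "L2 S = {v \<in> borel_measurable (lebesgue_on S). integrable (lebesgue_on S) (\<lambda>x. (v x)\<^sup>2)}"

definition L2norm :: "(real^'n) set \<Rightarrow> (real^'n \<Rightarrow> real) \<Rightarrow> real" where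
  "L2norm S v = sqrt (LINT x|lebesgue_on S. (v x)\<^sup>2)"

definition Linf :: "(real^'n) set \<Rightarrow> (real^'n \<Rightarrow> real) set" where
  "Linf S = {v \<in> borel_measurable (lebesgue_on S).
               esssup (lebesgue_on S) (\<lambda>x. ereal \<bar>v x\<bar>) < \<infinity>}"

definition Linf_norm :: "(real^'n) set \<Rightarrow> (real^'n \<Rightarrow> real) \<Rightarrow> real" where
  "Linf_norm S v = real_of_ereal (esssup (lebesgue_on S) (\<lambda>x. ereal \<bar>v x\<bar>))"

definition partial :: "'n \<Rightarrow> (real^'n \<Rightarrow> real) \<Rightarrow> real^'n \<Rightarrow> real" where
  "partial i \<phi> = (\<lambda>x. frechet_derivative \<phi> (at x) (axis i 1))"

primrec Ck :: "nat \<Rightarrow> (real^'n \<Rightarrow> real) \<Rightarrow> bool" where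
  "Ck 0 \<phi> \<longleftrightarrow> continuous_on UNIV \<phi>"
| "Ck (Suc k) \<phi> \<longleftrightarrow> (\<forall>x. \<phi> differentiable (at x)) \<and> (\<forall>i. Ck k (partial i \<phi>))"

definition Cc_inf :: "(real^'n) set \<Rightarrow> (real^'n \<Rightarrow> real) set" where
  "Cc_inf U = {\<phi>. (\<forall>k. Ck k \<phi>) \<and> compact (closure {x. \<phi> x \<noteq> 0}) \<and> closure {x. \<phi> x \<noteq> 0} \<subseteq> U}"

text \<open>A derivative of order \<open>j\<close> is addressed by a list of \<open>j\<close> coordinate directions, so that sums
  over all lists of length \<open>j\<close> give the Euclidean norm of the derivative tensor.\<close>

definition weak_deriv ::
  "(real^'n) set \<Rightarrow> 'n list \<Rightarrow> (real^'n \<Rightarrow> real) \<Rightarrow> (real^'n \<Rightarrow> real) \<Rightarrow> bool" where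
  "weak_deriv U is v g \<longleftrightarrow>
     (\<forall>\<phi>\<in>Cc_inf U. (LINT x|lebesgue_on U. v x * foldr partial is \<phi> x)
                  = (-1) ^ length is * (LINT x|lebesgue_on U. g x * \<phi> x))"

text \<open>Weak derivatives are unique up to null sets; the choice below picks a representative.\<close>

definition wderiv :: "(real^'n) set \<Rightarrow> 'n list \<Rightarrow> (real^'n \<Rightarrow> real) \<Rightarrow> real^'n \<Rightarrow> real" where
  "wderiv U is v = (SOME g. g \<in> L2 U \<and> weak_deriv U is v g)"

definition gagliardo :: "real \<Rightarrow> (real^'n) set \<Rightarrow> (real^'n \<Rightarrow> real) \<Rightarrow> ennreal" where
  "gagliardo \<sigma> U g = (\<integral>\<^sup>+ z \<in> U \<times> U. ennreal ((g (fst z) - g (snd z))\<^sup>2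
        / norm (fst z - snd z) powr (real CARD('n) + 2 * \<sigma>)) \<partial>lebesgue)"

text \<open>The Sobolev--Slobodeckij space \<open>H\<^sup>t(U)\<close> for real \<open>t \<ge> 0\<close>; the choice \<open>U = UNIV\<close> gives the
  space on the whole Euclidean space.\<close>

definition sobolev :: "real \<Rightarrow> (real^'n) set \<Rightarrow> (real^'n \<Rightarrow> real) set" where
  "sobolev t U = {v \<in> L2 U.
     (\<forall>is. length is \<le> nat \<lfloor>t\<rfloor> \<longrightarrow> (\<exists>g\<in>L2 U. weak_deriv U is v g)) \<and>
     (frac t > 0 \<longrightarrow>
        (\<forall>is. length is = nat \<lfloor>t\<rfloor> \<longrightarrow> gagliardo (frac t) U (wderiv U is v) < \<infinity>))}"

definition sobolev_norm :: "real \<Rightarrow> (real^'n) set \<Rightarrow> (real^'n \<Rightarrow> real) \<Rightarrow> real" where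
  "sobolev_norm t U v = sqrt
     ((\<Sum>is | length is \<le> nat \<lfloor>t\<rfloor>. (L2norm U (wderiv U is v))\<^sup>2)
      + (if frac t > 0
         then \<Sum>is | length is = nat \<lfloor>t\<rfloor>. enn2real (gagliardo (frac t) U (wderiv U is v))
         else 0))"

definition Htilde :: "real \<Rightarrow> (real^'n) set \<Rightarrow> (real^'n \<Rightarrow> real) set" where
  "Htilde t U = {v \<in> sobolev t UNIV.
     \<forall>e>0. \<exists>\<phi>\<in>Cc_inf U. sobolev_norm t UNIV (\<lambda>x. v x - \<phi> x) < e}"

text \<open>For \<open>0 < s < 1\<close>, the norm of \<open>H\<^sup>s\<close> on the whole space that serves as Tikhonov penalty. It is
  equivalent to \<open>sobolev_norm s UNIV\<close>; the seminorm carries the factor \<open>c/2\<close>, so that the penalty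
  \<open>a\<^sub>R(v,v) + \<parallel>v\<parallel>\<^sup>2\<close> of the discrete problem is its square for \<open>v\<close> vanishing outside \<open>\<Omega>\<close>.\<close>

definition Hs_norm :: "real \<Rightarrow> real \<Rightarrow> (real^'n \<Rightarrow> real) \<Rightarrow> real" where
  "Hs_norm c s v = sqrt ((L2norm UNIV v)\<^sup>2 + c / 2 * enn2real (gagliardo s UNIV v))"

text \<open>Here \<open>c\<close> is the normalization constant; only its positivity is ever assumed. The principal value
  integral extends over \<open>A\<close>, which is the whole space or the truncated domain. Where the principal
  value does not exist, the value is unspecified.\<close>

definition fracLap_on :: "real \<Rightarrow> real \<Rightarrow> (real^'n) set \<Rightarrow> (real^'n \<Rightarrow> real) \<Rightarrow> real^'n \<Rightarrow> real" where
  "fracLap_on c s A v x = c * Lim (at_right 0) (\<lambda>e. LINT y|lebesgue_on (A - cball x e).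
      (v x - v y) / norm (x - y) powr (real CARD('n) + 2 * s))"

abbreviation fracLap :: "real \<Rightarrow> real \<Rightarrow> (real^'n \<Rightarrow> real) \<Rightarrow> real^'n \<Rightarrow> real" where
  "fracLap c s \<equiv> fracLap_on c s UNIV"

text \<open>The distributional fractional Laplacian, restricted to \<open>D\<close>: the operator is moved to the test
  function, where it is given by the pointwise formula.\<close>

definition is_fracLap ::
  "real \<Rightarrow> real \<Rightarrow> (real^'n) set \<Rightarrow> (real^'n \<Rightarrow> real) \<Rightarrow> (real^'n \<Rightarrow> real) \<Rightarrow> bool" where
  "is_fracLap c s D v w \<longleftrightarrow> (\<forall>\<phi>\<in>Cc_inf D.
     (LINT x|lebesgue_on D. w x * \<phi> x) = (LINT x|lebesgue. v x * fracLap c s \<phi> x))"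

definition energy_on ::
  "real \<Rightarrow> real \<Rightarrow> (real^'n) set \<Rightarrow> (real^'n \<Rightarrow> real) \<Rightarrow> (real^'n \<Rightarrow> real) \<Rightarrow> real" where
  "energy_on c s A u v = c / 2 * (LINT z|lebesgue_on (A \<times> A).
      (u (fst z) - u (snd z)) * (v (fst z) - v (snd z))
        / norm (fst z - snd z) powr (real CARD('n) + 2 * s))"

definition a_R ::
  "real \<Rightarrow> real \<Rightarrow> (real^'n) set \<Rightarrow> (real^'n \<Rightarrow> real) \<Rightarrow> (real^'n \<Rightarrow> real) \<Rightarrow> real" where
  "a_R c s \<Omega>\<^sub>R u v = energy_on c s \<Omega>\<^sub>R u v
     + c * (LINT x|lebesgue_on \<Omega>\<^sub>R. u x * v x *
         (LINT y|lebesgue_on (- \<Omega>\<^sub>R). 1 / norm (x - y) powr (real CARD('n) + 2 * s)))"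

definition weak_solution :: "real \<Rightarrow> real \<Rightarrow> (real^'n) set \<Rightarrow> (real^'n \<Rightarrow> real) \<Rightarrow>
    (real^'n \<Rightarrow> real) \<Rightarrow> (real^'n \<Rightarrow> real) \<Rightarrow> bool" where
  "weak_solution c s \<Omega> q f u \<longleftrightarrow> u \<in> sobolev s UNIV \<and> (\<lambda>x. u x - f x) \<in> Htilde s \<Omega> \<and>
     (\<forall>\<phi>\<in>Htilde s \<Omega>. energy_on c s UNIV u \<phi> + (LINT x|lebesgue_on \<Omega>. q x * u x * \<phi> x) = 0)"

definition Lop :: "real \<Rightarrow> real \<Rightarrow> (real^'n) set \<Rightarrow> (real^'n \<Rightarrow> real) \<Rightarrow> real^'n \<Rightarrow> real" where
  "Lop c s \<Omega> v x = - c * (LINT y|lebesgue_on \<Omega>. v y / norm (x - y) powr (real CARD('n) + 2 * s))"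

definition lipschitz_polyhedral_domain :: "(real^'n) set \<Rightarrow> bool" where
  "lipschitz_polyhedral_domain \<Omega> \<longleftrightarrow> \<Omega> \<noteq> {} \<and> open \<Omega> \<and> connected \<Omega> \<and> bounded \<Omega> \<and>
     (\<exists>\<P>. finite \<P> \<and> (\<forall>P\<in>\<P>. polytope P) \<and> closure \<Omega> = \<Union>\<P>) \<and>
     (\<forall>x\<in>frontier \<Omega>. \<exists>e r L \<gamma>. norm e = 1 \<and> r > 0 \<and> L-lipschitz_on UNIV \<gamma> \<and>
        \<Omega> \<inter> ball x r = {y \<in> ball x r. \<gamma> (y - (y \<bullet> e) *\<^sub>R e) < y \<bullet> e})"

definition compactly_in :: "(real^'n) set \<Rightarrow> (real^'n) set \<Rightarrow> bool" where
  "compactly_in A B \<longleftrightarrow> compact (closure A) \<and> closure A \<subseteq> B"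

text \<open>A function \<open>f\<close> in \<open>Cc_inf W\<close> is its own zero extension. The noise in the data \<open>\<mu>\<^sup>\<delta>\<close> and \<open>g\<^sup>\<delta>\<close>
  is arbitrary; \<open>\<delta>\<close> is any bound for it.\<close>

definition continuous_setting ::
  "(real^'n) set \<Rightarrow> (real^'n) set \<Rightarrow> (real^'n) set \<Rightarrow> real \<Rightarrow> real \<Rightarrow> real \<Rightarrow>
   (real^'n \<Rightarrow> real) \<Rightarrow> (real^'n \<Rightarrow> real) \<Rightarrow> (real^'n \<Rightarrow> real) \<Rightarrow>
   real \<Rightarrow> (real^'n \<Rightarrow> real) \<Rightarrow> (real^'n \<Rightarrow> real) \<Rightarrow> bool" where
  "continuous_setting \<Omega> \<Omega>' W c s \<epsilon> f q u \<delta> \<mu>\<delta> g\<delta> \<longleftrightarrow>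
     lipschitz_polyhedral_domain \<Omega> \<and> open \<Omega>' \<and> compactly_in \<Omega>' \<Omega> \<and>
     W \<noteq> {} \<and> bounded W \<and> open W \<and> compactly_in W (- closure \<Omega>) \<and>
     c > 0 \<and> 0 < s \<and> s < 1 \<and> \<epsilon> > 0 \<and>
     f \<in> Cc_inf W \<and> f \<in> Htilde (s + \<epsilon>) W \<and> f \<noteq> (\<lambda>x. 0) \<and>
     q \<in> Linf \<Omega> \<and> closure {x. q x \<noteq> 0} \<subseteq> \<Omega>' \<and>
     weak_solution c s \<Omega> q f u \<and>
     \<mu>\<delta> \<in> L2 W \<and> L2norm W (\<lambda>x. \<mu>\<delta> x - Lop c s \<Omega> (\<lambda>y. u y - f y) x) \<le> \<delta> \<and>
     g\<delta> \<in> L2 W \<and> L2norm W (\<lambda>x. g\<delta> x - fracLap c s u x) \<le> \<delta>"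

definition J_state :: "real \<Rightarrow> real \<Rightarrow> (real^'n) set \<Rightarrow> (real^'n) set \<Rightarrow> (real^'n \<Rightarrow> real) \<Rightarrow>
    real \<Rightarrow> (real^'n \<Rightarrow> real) \<Rightarrow> real" where
  "J_state c s \<Omega> W \<mu>\<delta> \<alpha> v
     = (L2norm W (\<lambda>x. Lop c s \<Omega> v x - \<mu>\<delta> x))\<^sup>2 + \<alpha> * (Hs_norm c s v)\<^sup>2"

definition J_potential :: "(real^'n) set \<Rightarrow> (real^'n \<Rightarrow> real) \<Rightarrow> (real^'n \<Rightarrow> real) \<Rightarrow>
    real \<Rightarrow> (real^'n \<Rightarrow> real) \<Rightarrow> real" where
  "J_potential \<Omega>' w u \<alpha>\<^sub>q p = (L2norm \<Omega>' (\<lambda>x. w x + p x * u x))\<^sup>2 + \<alpha>\<^sub>q * (L2norm \<Omega>' p)\<^sup>2"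

definition simplicial :: "(real^'n) set set \<Rightarrow> bool" where
  "simplicial \<T> \<longleftrightarrow> triangulation \<T> \<and> (\<forall>K\<in>\<T>. int CARD('n) simplex K)"

definition mesh_of :: "(real^'n) set \<Rightarrow> (real^'n) set set \<Rightarrow> bool" where
  "mesh_of D \<T> \<longleftrightarrow> simplicial \<T> \<and> \<Union>\<T> = closure D"

definition mesh_size :: "(real^'n) set set \<Rightarrow> real" where
  "mesh_size \<T> = Max (diameter ` \<T>)"

definition shape_regular :: "real \<Rightarrow> (real^'n) set set \<Rightarrow> bool" where
  "shape_regular \<rho> \<T> \<longleftrightarrow> (\<forall>K\<in>\<T>. \<exists>z. cball z (\<rho> * diameter K) \<subseteq> K)"

definition quasi_uniform :: "real \<Rightarrow> (real^'n) set set \<Rightarrow> bool" where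
  "quasi_uniform \<rho> \<T> \<longleftrightarrow> (\<forall>K\<in>\<T>. \<exists>z. cball z (\<rho> * mesh_size \<T>) \<subseteq> K)"

definition fitted :: "(real^'n) set \<Rightarrow> (real^'n) set set \<Rightarrow> bool" where
  "fitted \<Omega> \<T> \<longleftrightarrow> (\<forall>K\<in>\<T>. K \<subseteq> closure \<Omega> \<or> K \<inter> \<Omega> = {})"

definition polys :: "nat \<Rightarrow> (real^'n \<Rightarrow> real) set" where
  "polys p = {P. \<exists>a :: ('n \<Rightarrow> nat) \<Rightarrow> real.
     P = (\<lambda>x. \<Sum>\<beta> | (\<Sum>i\<in>UNIV. \<beta> i) \<le> p. a \<beta> * (\<Prod>i\<in>UNIV. x $ i ^ \<beta> i))}"

text \<open>Finite element functions on \<open>closure D\<close> are extended by zero.\<close>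

definition fe_space :: "nat \<Rightarrow> (real^'n) set \<Rightarrow> (real^'n) set set \<Rightarrow> (real^'n \<Rightarrow> real) set" where
  "fe_space p D \<T> = {v. continuous_on (closure D) v \<and> (\<forall>x. x \<notin> closure D \<longrightarrow> v x = 0) \<and>
     (\<forall>K\<in>\<T>. \<exists>P\<in>polys p. \<forall>x\<in>K. v x = P x)}"

definition fe_space0 ::
  "nat \<Rightarrow> (real^'n) set \<Rightarrow> (real^'n) set \<Rightarrow> (real^'n) set set \<Rightarrow> (real^'n \<Rightarrow> real) set" where
  "fe_space0 p \<Omega> D \<T> = {v \<in> fe_space p D \<T>. \<forall>x\<in>D - \<Omega>. v x = 0}"

text \<open>Discontinuous piecewise polynomials on \<open>D\<close>; the elements need not be contained in \<open>D\<close>.\<close>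

definition dg_space :: "nat \<Rightarrow> (real^'n) set \<Rightarrow> (real^'n) set set \<Rightarrow> (real^'n \<Rightarrow> real) set" where
  "dg_space r D \<T> = {v \<in> Linf D \<inter> L2 D.
     \<forall>K\<in>\<T>. \<exists>P\<in>polys r. AE x in lebesgue_on (D \<inter> K). v x = P x}"

text \<open>The Lagrange nodes of degree \<open>p\<close>: in each simplex, the points whose barycentric coordinates
  are multiples of \<open>1/p\<close>.\<close>

definition nodes :: "nat \<Rightarrow> (real^'n) set set \<Rightarrow> (real^'n) set" where
  "nodes p \<T> = (\<Union>K\<in>\<T>. {(\<Sum>a | a extreme_point_of K. (real (k a) / real p) *\<^sub>R a) | k :: real^'n \<Rightarrow> nat.
     (\<Sum>a | a extreme_point_of K. k a) = p})"

definition nodal_interpolant :: "nat \<Rightarrow> (real^'n) set \<Rightarrow> (real^'n) set set \<Rightarrow>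
    (real^'n \<Rightarrow> real) \<Rightarrow> (real^'n \<Rightarrow> real) \<Rightarrow> bool" where
  "nodal_interpolant p D \<T> g v \<longleftrightarrow> v \<in> fe_space p D \<T> \<and> (\<forall>z\<in>nodes p \<T>. v z = g z)"

text \<open>Nodal basis functions, and likewise the vectors in \<open>Y\<close>, are indexed by the nodes themselves
  instead of by an enumeration of them.\<close>

definition nodal_basis ::
  "nat \<Rightarrow> (real^'n) set \<Rightarrow> (real^'n) set set \<Rightarrow> real^'n \<Rightarrow> real^'n \<Rightarrow> real" where
  "nodal_basis p D \<T> z = (THE v. nodal_interpolant p D \<T> (\<lambda>x. if x = z then 1 else 0) v)"

definition mass_matrix ::
  "nat \<Rightarrow> (real^'n) set \<Rightarrow> (real^'n) set set \<Rightarrow> real^'n \<Rightarrow> real^'n \<Rightarrow> real" where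
  "mass_matrix p W \<T> i j = (LINT x|lebesgue_on W. nodal_basis p W \<T> i x * nodal_basis p W \<T> j x)"

definition Y_normsq ::
  "nat \<Rightarrow> (real^'n) set \<Rightarrow> (real^'n) set set \<Rightarrow> (real^'n \<Rightarrow> real) \<Rightarrow> real" where
  "Y_normsq p W \<T> y = (\<Sum>i\<in>nodes p \<T>. \<Sum>j\<in>nodes p \<T>. y i * mass_matrix p W \<T> i j * y j)"

definition cube :: "real \<Rightarrow> (real^'n) set" where
  "cube R = box (\<chi> i. - R) (\<chi> i. R)"

text \<open>\<open>H\<close> is the set of mesh sizes and \<open>\<rho>\<close> the regularity constant, common to all meshes. \<open>\<T>\<close> is the
  mesh of the truncated domain, \<open>\<T>\<^sub>W\<close> the one of \<open>W\<close>, and \<open>\<T>\<^sub>Q\<close> the one on which the potential is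
  discretized, which is required only to cover \<open>\<Omega>'\<close>: it may be \<open>\<T>\<close> itself.\<close>

definition discrete_setting ::
  "(real^'n) set \<Rightarrow> (real^'n) set \<Rightarrow> (real^'n) set \<Rightarrow> real \<Rightarrow> nat \<Rightarrow> nat \<Rightarrow> real set \<Rightarrow>
   (real \<Rightarrow> (real^'n) set set) \<Rightarrow> (real \<Rightarrow> (real^'n) set set) \<Rightarrow> (real \<Rightarrow> (real^'n) set set) \<Rightarrow> bool"
  where
  "discrete_setting \<Omega> \<Omega>' W R p p\<^sub>W H \<T> \<T>\<^sub>W \<T>\<^sub>Q \<longleftrightarrow>
     \<Omega> \<union> W \<subseteq> cube R \<and> p \<ge> 1 \<and> p\<^sub>W \<ge> 1 \<and> H \<subseteq> {0<..} \<and>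
     (\<exists>\<rho>>0. \<forall>h\<in>H.
        mesh_of (cube R) (\<T> h) \<and> mesh_size (\<T> h) = h \<and> quasi_uniform \<rho> (\<T> h) \<and> fitted \<Omega> (\<T> h) \<and>
        mesh_of W (\<T>\<^sub>W h) \<and> shape_regular \<rho> (\<T>\<^sub>W h) \<and>
        simplicial (\<T>\<^sub>Q h) \<and> mesh_size (\<T>\<^sub>Q h) \<le> h \<and> \<Omega>' \<subseteq> \<Union>(\<T>\<^sub>Q h))"

definition J_state_h :: "real \<Rightarrow> real \<Rightarrow> (real^'n) set \<Rightarrow> (real^'n) set \<Rightarrow> real \<Rightarrow> nat \<Rightarrow>
    (real^'n) set set \<Rightarrow> (real^'n \<Rightarrow> real) \<Rightarrow> (real^'n \<Rightarrow> real) \<Rightarrow> real \<Rightarrow> (real^'n \<Rightarrow> real) \<Rightarrow> real" where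
  "J_state_h c s \<Omega> W R p\<^sub>W \<T>\<^sub>W g\<delta> uf \<alpha> v =
     Y_normsq p\<^sub>W W \<T>\<^sub>W (\<lambda>z. Lop c s \<Omega> v z - (g\<delta> z - fracLap_on c s (cube R) uf z))
     + \<alpha> * (a_R c s (cube R) v v + (L2norm (cube R) v)\<^sup>2)"

definition fracLap_rec_h :: "real \<Rightarrow> real \<Rightarrow> (real^'n) set \<Rightarrow> real \<Rightarrow> nat \<Rightarrow> (real^'n) set set \<Rightarrow>
    (real^'n \<Rightarrow> real) \<Rightarrow> (real^'n \<Rightarrow> real) \<Rightarrow> bool" where
  "fracLap_rec_h c s \<Omega> R p \<T> u w \<longleftrightarrow> w \<in> fe_space0 p \<Omega> (cube R) \<T> \<and>
     (\<forall>\<phi>\<in>fe_space0 p \<Omega> (cube R) \<T>.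
        (LINT x|lebesgue_on \<Omega>. w x * \<phi> x) = a_R c s (cube R) u \<phi>)"

end

theory Submission
  imports Defs
begin

text \<open>The exact potential satisfies a normal equation for every test function in \<open>L\<^sup>2\<close>, the discrete
  one for test functions in \<open>Q\<^sub>h\<close>. Subtracting them and testing with \<open>\<theta> = q\<^sub>h - I\<^sub>Q q\<close> gives
  \<open>(\<theta> u\<^sub>h, \<theta> u\<^sub>h) + \<alpha>\<^sub>q (\<theta>, \<theta>)\<close> on the left and, on the right, terms that are linear in the errors of
  \<open>w\<close>, \<open>u\<close> and of the interpolation of \<open>q\<close>, each tested with \<open>\<theta>\<close>. The coercivity constant \<open>\<alpha>\<^sub>q\<close> does not
  involve \<open>\<kappa>\<^sub>0\<close>; the factor \<open>\<kappa>\<^sub>0\<^sup>-\<^sup>2\<close> comes for free, because \<open>\<kappa>\<^sub>0 \<le> \<parallel>u\<^sub>\<alpha>\<parallel>\<close> in \<open>L\<^sup>\<infinity>\<close> unless \<open>\<Omega>'\<close> is a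
  null set.\<close>

section \<open>Square-integrable functions: products, Cauchy-Schwarz, triangle inequality\<close>

abbreviation L2ip :: "(real^'n) set \<Rightarrow> (real^'n \<Rightarrow> real) \<Rightarrow> (real^'n \<Rightarrow> real) \<Rightarrow> real" where
  "L2ip S f g \<equiv> LINT x|lebesgue_on S. f x * g x"

text \<open>Evaluating at the vertex of the parabola gives the bound once \<open>c > 0\<close> is
  known. This yields Cauchy-Schwarz; with \<open>a = 0\<close> it forces \<open>b = 0\<close>, the
  first-order condition at a minimizer.\<close>

lemma quadratic_nonneg_discrim:
  fixes a b c :: real
  assumes "\<And>t. 0 \<le> a + 2 * t * b + t\<^sup>2 * c"
  shows "b\<^sup>2 \<le> a * c"
proof (cases "c = 0")
  case True
  have "b = 0"
  proof (rule ccontr)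
    assume "b \<noteq> 0"
    \<comment> \<open>At this \<open>t\<close> the affine function takes the value -1.\<close>
    then show False
      using assms[of "- (a + 1) / (2 * b)"] True by (simp add: field_simps)
  qed
  then show ?thesis using True by simp
next
  case False
  have "c > 0"
  proof (rule ccontr)
    assume "\<not> c > 0"
    then have c: "c < 0" using False by simp
    \<comment> \<open>For this \<open>t\<close> the quadratic term equals
      \<open>t * c - t * (\<bar>a\<bar> + 2 * \<bar>b\<bar>)\<close>. It absorbs the other two
      terms, as \<open>t \<ge> 1\<close>, and leaves at most \<open>t * c < 0\<close>.\<close>
    define t where "t = 1 + (\<bar>a\<bar> + 2 * \<bar>b\<bar>) / - c"
    have t: "t \<ge> 1" using c unfolding t_def by (simp add: divide_nonneg_neg zero_le_divide_iff)
    have "t * - c = - c + (\<bar>a\<bar> + 2 * \<bar>b\<bar>)" using c unfolding t_def by (simp add: field_simps)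
    then have "t * (t * c) = t * (c - (\<bar>a\<bar> + 2 * \<bar>b\<bar>))" by simp
    moreover have "a \<le> t * \<bar>a\<bar>"
      using mult_right_mono[OF t, of "\<bar>a\<bar>"] by simp
    moreover have "2 * t * b \<le> t * (2 * \<bar>b\<bar>)" using t by (simp add: mult_left_mono)
    moreover have "t * c < 0" using t c by (simp add: mult_pos_neg)
    ultimately show False using assms[of t] by (simp add: algebra_simps power2_eq_square)
  qed
  have "(a + 2 * (- b / c) * b + (- b / c)\<^sup>2 * c) * c = a * c - b\<^sup>2"
    using False by (simp add: field_simps power2_eq_square)
  moreover have "0 \<le> (a + 2 * (- b / c) * b + (- b / c)\<^sup>2 * c) * c"
    using assms[of "- b / c"] \<open>c > 0\<close> by (intro mult_nonneg_nonneg) auto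
  ultimately show ?thesis by linarith
qed

lemma L2_measurable: "f \<in> L2 S \<Longrightarrow> f \<in> borel_measurable (lebesgue_on S)"
  by (simp add: L2_def)

lemma L2_mult_integrable:
  assumes "f \<in> L2 S" "g \<in> L2 S"
  shows "integrable (lebesgue_on S) (\<lambda>x. f x * g x)"
proof (rule Bochner_Integration.integrable_bound)
  show "integrable (lebesgue_on S) (\<lambda>x. (f x)\<^sup>2 + (g x)\<^sup>2)"
    using assms by (auto simp: L2_def)
  show "(\<lambda>x. f x * g x) \<in> borel_measurable (lebesgue_on S)"
    using assms by (auto simp: L2_def)
  have "norm (a * b) \<le> norm (a\<^sup>2 + b\<^sup>2)" for a b :: real
  proof -
    have "2 * (\<bar>a\<bar> * \<bar>b\<bar>) \<le> a\<^sup>2 + b\<^sup>2"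
      using zero_le_power2[of "\<bar>a\<bar> - \<bar>b\<bar>"] by (simp add: power2_diff)
    moreover have "0 \<le> \<bar>a\<bar> * \<bar>b\<bar>" by simp
    ultimately have "\<bar>a\<bar> * \<bar>b\<bar> \<le> a\<^sup>2 + b\<^sup>2" by linarith
    then show ?thesis by (simp add: abs_mult)
  qed
  then show "AE x in lebesgue_on S. norm (f x * g x) \<le> norm ((f x)\<^sup>2 + (g x)\<^sup>2)" by simp
qed

lemma L2_add_scaled:
  assumes "f \<in> L2 S" "g \<in> L2 S"
  shows "(\<lambda>x. f x + t * g x) \<in> L2 S"
proof -
  have "integrable (lebesgue_on S) (\<lambda>x. (f x)\<^sup>2 + 2 * t * (f x * g x) + t\<^sup>2 * (g x)\<^sup>2)"
    using assms L2_mult_integrable[OF assms] by (auto simp: L2_def)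
  also have "(\<lambda>x. (f x)\<^sup>2 + 2 * t * (f x * g x) + t\<^sup>2 * (g x)\<^sup>2) = (\<lambda>x. (f x + t * g x)\<^sup>2)"
    by (simp add: fun_eq_iff power2_eq_square algebra_simps)
  finally show ?thesis using assms by (auto simp: L2_def)
qed

lemma L2_add: "f \<in> L2 S \<Longrightarrow> g \<in> L2 S \<Longrightarrow> (\<lambda>x. f x + g x) \<in> L2 S"
  using L2_add_scaled[of f S g 1] by simp

lemma L2_diff: "f \<in> L2 S \<Longrightarrow> g \<in> L2 S \<Longrightarrow> (\<lambda>x. f x - g x) \<in> L2 S"
  using L2_add_scaled[of f S g "-1"] by simp

lemma L2norm_nonneg: "0 \<le> L2norm S f"
  by (simp add: L2norm_def)

lemma L2norm_power2: "(L2norm S f)\<^sup>2 = L2ip S f f"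
  by (simp add: L2norm_def power2_eq_square)

lemma L2norm_eq_0_if_null:
  assumes "emeasure (lebesgue_on S) (space (lebesgue_on S)) = 0"
  shows "L2norm S f = 0"
proof -
  have "AE x in lebesgue_on S. (f x)\<^sup>2 = 0"
    by (rule AE_I[OF _ assms]) auto
  then have "(LINT x|lebesgue_on S. (f x)\<^sup>2) = 0"
    by (rule integral_eq_zero_AE)
  then show ?thesis by (simp add: L2norm_def)
qed

text \<open>Along a line the squared norm is a quadratic polynomial in \<open>t\<close>. Both
  Cauchy-Schwarz and the expansion of \<open>J_potential\<close> around its minimizer start from
  this.\<close>

lemma L2norm_add_scaled_power2:
  assumes f: "f \<in> L2 S" and g: "g \<in> L2 S"
  shows "(L2norm S (\<lambda>x. f x + t * g x))\<^sup>2 = (L2norm S f)\<^sup>2 + 2 * t * L2ip S f g + t\<^sup>2 * (L2norm S g)\<^sup>2"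
proof -
  note [simp] = L2_mult_integrable[OF f f] L2_mult_integrable[OF f g] L2_mult_integrable[OF g g]
  have "L2ip S (\<lambda>x. f x + t * g x) (\<lambda>x. f x + t * g x)
      = (LINT x|lebesgue_on S. f x * f x + 2 * t * (f x * g x) + t\<^sup>2 * (g x * g x))"
    by (rule Bochner_Integration.integral_cong) (auto simp: power2_eq_square algebra_simps)
  then show ?thesis by (simp add: L2norm_power2)
qed

lemma L2_Cauchy_Schwarz:
  assumes "f \<in> L2 S" "g \<in> L2 S"
  shows "\<bar>L2ip S f g\<bar> \<le> L2norm S f * L2norm S g"
proof -
  have "(L2ip S f g)\<^sup>2 \<le> (L2norm S f)\<^sup>2 * (L2norm S g)\<^sup>2"
    by (rule quadratic_nonneg_discrim)
      (metis L2norm_add_scaled_power2[OF assms] zero_le_power2)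
  then have "\<bar>L2ip S f g\<bar>\<^sup>2 \<le> (L2norm S f * L2norm S g)\<^sup>2"
    by (simp add: power_mult_distrib)
  then show ?thesis by (rule power2_le_imp_le) (simp add: L2norm_nonneg)
qed

lemma L2norm_triangle:
  assumes "f \<in> L2 S" "g \<in> L2 S"
  shows "L2norm S (\<lambda>x. f x + g x) \<le> L2norm S f + L2norm S g"
proof (rule power2_le_imp_le)
  show "(L2norm S (\<lambda>x. f x + g x))\<^sup>2 \<le> (L2norm S f + L2norm S g)\<^sup>2"
    using L2norm_add_scaled_power2[OF assms, of 1] L2_Cauchy_Schwarz[OF assms]
    by (simp add: power2_sum)
qed (simp add: L2norm_nonneg)

lemma L2norm_minus_commute: "L2norm S (\<lambda>x. f x - g x) = L2norm S (\<lambda>x. g x - f x)"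
  by (simp add: L2norm_def power2_commute)

lemma
  assumes f: "f \<in> L2 S" and g: "g \<in> borel_measurable (lebesgue_on S)"
    and K: "AE x in lebesgue_on S. \<bar>g x\<bar> \<le> K" "K \<ge> 0"
  shows L2_mult_bounded: "(\<lambda>x. f x * g x) \<in> L2 S"
    and L2norm_mult_bounded: "L2norm S (\<lambda>x. f x * g x) \<le> K * L2norm S f"
proof -
  have int: "integrable (lebesgue_on S) (\<lambda>x. K\<^sup>2 * (f x)\<^sup>2)"
    using f by (auto simp: L2_def)
  have AE: "AE x in lebesgue_on S. (f x * g x)\<^sup>2 \<le> K\<^sup>2 * (f x)\<^sup>2"
    using K(1)
  proof eventually_elim
    case (elim x)
    then have "(g x)\<^sup>2 \<le> K\<^sup>2" using power_mono[OF elim abs_ge_zero, of 2] by simp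
    then show ?case
      by (simp add: power_mult_distrib mult.commute[of "K\<^sup>2"] mult_left_mono)
  qed
  have m: "(\<lambda>x. f x * g x) \<in> borel_measurable (lebesgue_on S)"
    using g L2_measurable[OF f] by simp
  have int2: "integrable (lebesgue_on S) (\<lambda>x. (f x * g x)\<^sup>2)"
    by (rule Bochner_Integration.integrable_bound[OF int])
      (use AE m in \<open>auto simp: borel_measurable_power\<close>)
  with m show "(\<lambda>x. f x * g x) \<in> L2 S" by (simp add: L2_def)
  have "(LINT x|lebesgue_on S. (f x * g x)\<^sup>2) \<le> K\<^sup>2 * (LINT x|lebesgue_on S. (f x)\<^sup>2)"
    using integral_mono_AE[OF int2 int AE] by simp
  from real_sqrt_le_mono[OF this] show "L2norm S (\<lambda>x. f x * g x) \<le> K * L2norm S f"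
    using K(2) by (simp add: L2norm_def real_sqrt_mult)
qed

section \<open>Essentially bounded functions\<close>

lemma Linf_AE_bound:
  assumes "v \<in> Linf S"
  shows "AE x in lebesgue_on S. \<bar>v x\<bar> \<le> Linf_norm S v"
proof -
  let ?e = "esssup (lebesgue_on S) (\<lambda>x. ereal \<bar>v x\<bar>)"
  have "AE x in lebesgue_on S. ereal \<bar>v x\<bar> \<le> ?e" by (rule esssup_AE)
  moreover have "?e < \<infinity>" using assms by (simp add: Linf_def)
  ultimately show ?thesis unfolding Linf_norm_def
    by (cases ?e) auto
qed

lemma Linf_I:
  assumes "v \<in> borel_measurable (lebesgue_on S)" "AE x in lebesgue_on S. \<bar>v x\<bar> \<le> K"
  shows "v \<in> Linf S"
proof -
  have "esssup (lebesgue_on S) (\<lambda>x. ereal \<bar>v x\<bar>) \<le> ereal K"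
    using assms by (intro esssup_I) auto
  then show ?thesis using assms(1) by (auto simp: Linf_def intro: le_less_trans)
qed

text \<open>This includes the degenerate cases: on a null space or for a non-measurable function the
  essential supremum is infinite, and \<open>real_of_ereal\<close> sends both infinities to
  0.\<close>

lemma Linf_norm_nonneg: "0 \<le> Linf_norm S v"
proof (cases "emeasure (lebesgue_on S) (space (lebesgue_on S)) = 0 \<or>
    (\<lambda>x. ereal \<bar>v x\<bar>) \<notin> borel_measurable (lebesgue_on S)")
  case True
  then have "esssup (lebesgue_on S) (\<lambda>x. ereal \<bar>v x\<bar>) \<in> {- \<infinity>, \<infinity>}"
    using esssup_zero_space esssup_non_measurable by (metis insertCI top_ereal_def)
  then show ?thesis by (auto simp: Linf_norm_def)
next
  case False
  then have "0 \<le> esssup (lebesgue_on S) (\<lambda>x. ereal \<bar>v x\<bar>)"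
    using esssup_const[of "lebesgue_on S" "0::ereal"] esssup_mono[of "\<lambda>x. 0" "lebesgue_on S" "\<lambda>x. ereal \<bar>v x\<bar>"]
    by simp
  then show ?thesis by (simp add: Linf_norm_def real_of_ereal_pos)
qed

lemma Linf_add_scaled:
  assumes "u \<in> Linf S" "v \<in> Linf S"
  shows "(\<lambda>x. u x + t * v x) \<in> Linf S"
proof (rule Linf_I)
  show "(\<lambda>x. u x + t * v x) \<in> borel_measurable (lebesgue_on S)"
    using assms by (auto simp: Linf_def)
  show "AE x in lebesgue_on S. \<bar>u x + t * v x\<bar> \<le> Linf_norm S u + \<bar>t\<bar> * Linf_norm S v"
    using Linf_AE_bound[OF assms(1)] Linf_AE_bound[OF assms(2)]
  proof eventually_elim
    case (elim x)
    have "\<bar>u x + t * v x\<bar> \<le> \<bar>u x\<bar> + \<bar>t\<bar> * \<bar>v x\<bar>"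
      by (metis abs_mult abs_triangle_ineq)
    also have "\<dots> \<le> Linf_norm S u + \<bar>t\<bar> * Linf_norm S v"
      using elim by (intro add_mono mult_left_mono) auto
    finally show ?case .
  qed
qed

lemma continuous_on_imp_Linf:
  assumes "compact K" "continuous_on K v" "open S" "S \<subseteq> K"
  shows "v \<in> Linf S"
proof -
  have "compact (v ` K)" using assms compact_continuous_image by blast
  then obtain b where b: "\<And>x. x \<in> K \<Longrightarrow> \<bar>v x\<bar> \<le> b"
    using compact_imp_bounded bounded_iff by (metis image_eqI real_norm_def)
  show ?thesis
  proof (rule Linf_I)
    show "v \<in> borel_measurable (lebesgue_on S)"
      using assms continuous_on_subset
      by (intro continuous_imp_measurable_on_sets_lebesgue) (auto intro: lmeasurable_open)
    show "AE x in lebesgue_on S. \<bar>v x\<bar> \<le> b"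
      using b assms(4) by (intro AE_I2) auto
  qed
qed

lemma Linf_imp_L2:
  assumes "v \<in> Linf S" "open S" "bounded S"
  shows "v \<in> L2 S"
proof -
  have S: "S \<in> lmeasurable" using assms lmeasurable_open by blast
  then interpret finite_measure "lebesgue_on S" by (rule finite_measure_lebesgue_on)
  \<comment> \<open>\<open>v\<close> is the constant 1, square-integrable since \<open>S\<close> has
    finite measure, times a bounded factor.\<close>
  have "integrable (lebesgue_on S) (\<lambda>x. (1::real)\<^sup>2)" by simp
  then have "(\<lambda>x. 1) \<in> L2 S" by (simp add: L2_def)
  moreover have "v \<in> borel_measurable (lebesgue_on S)" using assms(1) by (simp add: Linf_def)
  ultimately show ?thesis
    using L2_mult_bounded[OF _ _ Linf_AE_bound[OF assms(1)] Linf_norm_nonneg, of "\<lambda>x. 1"] by simp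
qed

section \<open>Finite element spaces\<close>

lemma fe_space_imp_Linf:
  assumes "v \<in> fe_space p D \<T>" "bounded D" "open S" "S \<subseteq> D"
  shows "v \<in> Linf S"
  using assms closure_subset[of D]
  by (intro continuous_on_imp_Linf[of "closure D"]) (auto simp: fe_space_def)

lemma polys_add_scaled:
  assumes "P \<in> polys r" "Q \<in> polys r"
  shows "(\<lambda>x. P x + t * Q x) \<in> polys r"
proof -
  obtain a b where "P = (\<lambda>x. \<Sum>\<beta> | (\<Sum>i\<in>UNIV. \<beta> i) \<le> r. a \<beta> * (\<Prod>i\<in>UNIV. x $ i ^ \<beta> i))"
    and "Q = (\<lambda>x. \<Sum>\<beta> | (\<Sum>i\<in>UNIV. \<beta> i) \<le> r. b \<beta> * (\<Prod>i\<in>UNIV. x $ i ^ \<beta> i))"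
    using assms by (auto simp: polys_def)
  then have "(\<lambda>x. P x + t * Q x) =
      (\<lambda>x. \<Sum>\<beta> | (\<Sum>i\<in>UNIV. \<beta> i) \<le> r. (a \<beta> + t * b \<beta>) * (\<Prod>i\<in>UNIV. x $ i ^ \<beta> i))"
    by (simp add: fun_eq_iff sum.distrib sum_distrib_left algebra_simps)
  then show ?thesis unfolding polys_def
    by (intro CollectI exI[of _ "\<lambda>\<beta>. a \<beta> + t * b \<beta>"])
qed

text \<open>Makes the test function \<open>q' - g\<close> and the perturbations of \<open>q'\<close>
  along it admissible in the discrete minimization.\<close>

lemma dg_space_add_scaled:
  assumes "v \<in> dg_space r D \<T>" "w \<in> dg_space r D \<T>"
  shows "(\<lambda>x. v x + t * w x) \<in> dg_space r D \<T>"
proof -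
  have "\<exists>P\<in>polys r. AE x in lebesgue_on (D \<inter> K). v x + t * w x = P x" if "K \<in> \<T>" for K
  proof -
    have "\<forall>K\<in>\<T>. \<exists>P\<in>polys r. AE x in lebesgue_on (D \<inter> K). v x = P x"
      and "\<forall>K\<in>\<T>. \<exists>P\<in>polys r. AE x in lebesgue_on (D \<inter> K). w x = P x"
      using assms by (simp_all add: dg_space_def)
    from this[THEN bspec, OF that] obtain P Q
      where P: "P \<in> polys r" "AE x in lebesgue_on (D \<inter> K). v x = P x"
        and Q: "Q \<in> polys r" "AE x in lebesgue_on (D \<inter> K). w x = Q x"
      by (elim bexE)
    have "AE x in lebesgue_on (D \<inter> K). v x + t * w x = P x + t * Q x"
      using P(2) Q(2) by eventually_elim simp
    then show ?thesis using polys_add_scaled[OF P(1) Q(1)] by (rule bexI)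
  qed
  moreover have "(\<lambda>x. v x + t * w x) \<in> Linf D \<inter> L2 D"
    using assms by (simp add: dg_space_def Linf_add_scaled L2_add_scaled)
  ultimately show ?thesis by (simp add: dg_space_def)
qed

section \<open>The regularized least-squares problem for the potential\<close>

text \<open>Along \<open>q + t * \<phi>\<close> the functional is its minimum plus
  \<open>2 * t * b + t\<^sup>2 * c\<close>, so \<open>b\<close> must vanish. Admissibility
  \<open>P\<close> is required on this line only, which covers minimization over all of
  \<open>L2\<close> as well as over \<open>dg_space\<close>.\<close>

lemma J_potential_normal_eq:
  assumes min: "is_arg_min (J_potential S w u \<alpha>) P q"
    and P: "\<And>t. P (\<lambda>x. q x + t * \<phi> x)"
    and w: "w \<in> L2 S" and u: "u \<in> Linf S" and q: "q \<in> L2 S" and \<phi>: "\<phi> \<in> L2 S"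
  shows "L2ip S (\<lambda>x. (w x + q x * u x) * u x) \<phi> + \<alpha> * L2ip S q \<phi> = 0"
proof -
  have um: "u \<in> borel_measurable (lebesgue_on S)" using u by (simp add: Linf_def)
  note mult_u = L2_mult_bounded[OF _ um Linf_AE_bound[OF u] Linf_norm_nonneg]
  have wqu: "(\<lambda>x. w x + q x * u x) \<in> L2 S" using L2_add[OF w mult_u[OF q]] .
  define b where "b = L2ip S (\<lambda>x. w x + q x * u x) (\<lambda>x. \<phi> x * u x) + \<alpha> * L2ip S q \<phi>"
  define c where "c = (L2norm S (\<lambda>x. \<phi> x * u x))\<^sup>2 + \<alpha> * (L2norm S \<phi>)\<^sup>2"
  have J: "J_potential S w u \<alpha> (\<lambda>x. q x + t * \<phi> x) = J_potential S w u \<alpha> q + 2 * t * b + t\<^sup>2 * c" for t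
  proof -
    have "(\<lambda>x. w x + (q x + t * \<phi> x) * u x) = (\<lambda>x. (w x + q x * u x) + t * (\<phi> x * u x))"
      by (simp add: fun_eq_iff algebra_simps)
    then show ?thesis
      using L2norm_add_scaled_power2[OF wqu mult_u[OF \<phi>], of t] L2norm_add_scaled_power2[OF q \<phi>, of t]
      by (simp add: J_potential_def b_def c_def algebra_simps)
  qed
  have "b\<^sup>2 \<le> 0 * c"
  proof (rule quadratic_nonneg_discrim)
    fix t
    have "J_potential S w u \<alpha> q \<le> J_potential S w u \<alpha> (\<lambda>x. q x + t * \<phi> x)"
      using min P[of t] unfolding is_arg_min_def not_less[symmetric] by blast
    then show "0 \<le> 0 + 2 * t * b + t\<^sup>2 * c" using J[of t] by linarith
  qed
  then have "b = 0" by simp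
  then show ?thesis by (simp add: b_def mult.assoc mult.commute[of "u _"])
qed

text \<open>Comparison with the zero potential. It replaces the norm of \<open>q\<close> in the
  final constant by data of the problem.\<close>

lemma J_potential_minimizer_bound:
  assumes min: "is_arg_min (J_potential S w u \<alpha>) (\<lambda>v. v \<in> L2 S) q" and "\<alpha> > 0"
  shows "L2norm S q \<le> L2norm S w / sqrt \<alpha>"
proof -
  have "(\<lambda>x. 0) \<in> L2 S" by (simp add: L2_def)
  then have "J_potential S w u \<alpha> q \<le> J_potential S w u \<alpha> (\<lambda>x. 0)"
    using min by (auto simp: is_arg_min_def not_less)
  then have "(L2norm S (\<lambda>x. w x + q x * u x))\<^sup>2 + \<alpha> * (L2norm S q)\<^sup>2 \<le> (L2norm S w)\<^sup>2"
    by (simp add: J_potential_def L2norm_def[of S "\<lambda>x. 0"])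
  then have "\<alpha> * (L2norm S q)\<^sup>2 \<le> (L2norm S w)\<^sup>2"
    using zero_le_power2[of "L2norm S (\<lambda>x. w x + q x * u x)"] by linarith
  then have "(sqrt \<alpha> * L2norm S q)\<^sup>2 \<le> (L2norm S w)\<^sup>2"
    using \<open>\<alpha> > 0\<close> by (simp add: power_mult_distrib)
  then have "sqrt \<alpha> * L2norm S q \<le> L2norm S w"
    by (rule power2_le_imp_le) (rule L2norm_nonneg)
  then show ?thesis using \<open>\<alpha> > 0\<close> by (simp add: field_simps)
qed

section \<open>Error estimate for the potential\<close>

text \<open>The difference of the two normal equations, tested with
  \<open>\<theta> = q' - g\<close>, is coercive thanks to the penalty \<open>\<alpha>\<close>; every
  remaining term is an inner product of an error with \<open>\<theta>\<close>.\<close>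

lemma potential_error:
  assumes L2: "w \<in> L2 S" "w' \<in> L2 S" "q \<in> L2 S" "q' \<in> L2 S" "g \<in> L2 S"
    and u: "u \<in> Linf S" and u': "u' \<in> Linf S"
    and U: "AE x in lebesgue_on S. \<bar>u x\<bar> \<le> U" and V: "AE x in lebesgue_on S. \<bar>u' x\<bar> \<le> V"
    and E: "AE x in lebesgue_on S. \<bar>u' x - u x\<bar> \<le> E"
    and nn: "0 \<le> U" "0 \<le> V" "0 \<le> E" and \<alpha>: "\<alpha> > 0"
    and eq: "L2ip S (\<lambda>x. (w x + q x * u x) * u x) (\<lambda>x. q' x - g x) + \<alpha> * L2ip S q (\<lambda>x. q' x - g x) = 0"
    and eq': "L2ip S (\<lambda>x. (w' x + q' x * u' x) * u' x) (\<lambda>x. q' x - g x) + \<alpha> * L2ip S q' (\<lambda>x. q' x - g x) = 0"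
  shows "\<alpha> * L2norm S (\<lambda>x. q' x - g x) \<le> V * L2norm S (\<lambda>x. w' x - w x)
    + (L2norm S w + (U + V) * L2norm S q) * E + (V\<^sup>2 + \<alpha>) * L2norm S (\<lambda>x. q x - g x)"
proof -
  have m: "u \<in> borel_measurable (lebesgue_on S)" "u' \<in> borel_measurable (lebesgue_on S)"
    using u u' by (simp_all add: Linf_def)
  then have md: "(\<lambda>x. u' x - u x) \<in> borel_measurable (lebesgue_on S)"
    and ma: "(\<lambda>x. u' x + u x) \<in> borel_measurable (lebesgue_on S)" by simp_all
  have A: "AE x in lebesgue_on S. \<bar>u' x + u x\<bar> \<le> U + V"
    using U V by eventually_elim linarith
  define \<theta> where "\<theta> = (\<lambda>x. q' x - g x)"
  define dw where "dw = (\<lambda>x. w' x - w x)"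
  define e where "e = (\<lambda>x. q x - g x)"
  have \<theta>: "\<theta> \<in> L2 S" and dw: "dw \<in> L2 S" and e: "e \<in> L2 S"
    unfolding \<theta>_def dw_def e_def using L2 by (auto intro: L2_diff)
  note mu = L2_mult_bounded[OF _ m(1) U nn(1)]
  note mu' = L2_mult_bounded[OF _ m(2) V nn(2)] and nu' = L2norm_mult_bounded[OF _ m(2) V nn(2)]
  note nd = L2norm_mult_bounded[OF _ md E nn(3)] and md = L2_mult_bounded[OF _ md E nn(3)]
  have UV: "0 \<le> U + V" using nn by simp
  note na = L2norm_mult_bounded[OF _ ma A UV] and ma = L2_mult_bounded[OF _ ma A UV]
  \<comment> \<open>With \<open>q' - q = \<theta> - e\<close>, the difference \<open>G' - G\<close>
    equals \<open>f1 + f2 + f3 - f4\<close> plus \<open>\<theta> * u'\<^sup>2\<close>. In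
    \<open>f3\<close>, the difference of squares is factored to exhibit the error
    \<open>u' - u\<close>.\<close>
  define f1 where "f1 = (\<lambda>x. dw x * u' x)"
  define f2 where "f2 = (\<lambda>x. w x * (u' x - u x))"
  define f3 where "f3 = (\<lambda>x. q x * (u' x + u x) * (u' x - u x))"
  define f4 where "f4 = (\<lambda>x. e x * u' x * u' x)"
  define \<theta>u where "\<theta>u = (\<lambda>x. \<theta> x * u' x)"
  have f: "f1 \<in> L2 S" "f2 \<in> L2 S" "f3 \<in> L2 S" "f4 \<in> L2 S" "\<theta>u \<in> L2 S"
    unfolding f1_def f2_def f3_def f4_def \<theta>u_def
    by (intro mu' dw, intro md L2, intro md ma L2, intro mu' e, intro mu' \<theta>)
  have nf1: "L2norm S f1 \<le> V * L2norm S dw" unfolding f1_def by (rule nu'[OF dw])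
  have nf2: "L2norm S f2 \<le> E * L2norm S w" unfolding f2_def by (rule nd[OF L2(1)])
  have nf3: "L2norm S f3 \<le> E * ((U + V) * L2norm S q)"
    unfolding f3_def using nd[OF ma[OF L2(3)]] mult_left_mono[OF na[OF L2(3)] nn(3)] by linarith
  have nf4: "L2norm S f4 \<le> V * (V * L2norm S e)"
    unfolding f4_def using nu'[OF mu'[OF e]] mult_left_mono[OF nu'[OF e] nn(2)] by linarith
  define G where "G = (\<lambda>x. (w x + q x * u x) * u x)"
  define G' where "G' = (\<lambda>x. (w' x + q' x * u' x) * u' x)"
  have G: "G \<in> L2 S" "G' \<in> L2 S" unfolding G_def G'_def
    by (intro mu L2_add L2, intro mu' L2_add L2)
  note I = L2_mult_integrable[OF _ \<theta>]
  note [simp] = I[OF G(1)] I[OF G(2)] I[OF f(1)] I[OF f(2)] I[OF f(3)] I[OF f(4)]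
    L2_mult_integrable[OF f(5) f(5)] I[OF \<theta>] I[OF e] I[OF L2(3)] I[OF L2(4)]
  \<comment> \<open>The identity is purely algebraic; the two brackets integrate to the normal
    equations and vanish.\<close>
  have pointwise: "\<theta>u x * \<theta>u x + \<alpha> * (\<theta> x * \<theta> x)
      = (G' x * \<theta> x + \<alpha> * (q' x * \<theta> x)) - (G x * \<theta> x + \<alpha> * (q x * \<theta> x))
        - f1 x * \<theta> x - f2 x * \<theta> x - f3 x * \<theta> x + f4 x * \<theta> x + \<alpha> * (e x * \<theta> x)" for x
    unfolding \<theta>u_def f1_def f2_def f3_def f4_def G_def G'_def dw_def e_def \<theta>_def
    by (simp add: algebra_simps)
  have "L2ip S \<theta>u \<theta>u + \<alpha> * L2ip S \<theta> \<theta>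
      = (LINT x|lebesgue_on S. \<theta>u x * \<theta>u x + \<alpha> * (\<theta> x * \<theta> x))" by simp
  also have "\<dots> = (L2ip S G' \<theta> + \<alpha> * L2ip S q' \<theta>) - (L2ip S G \<theta> + \<alpha> * L2ip S q \<theta>)
        - L2ip S f1 \<theta> - L2ip S f2 \<theta> - L2ip S f3 \<theta> + L2ip S f4 \<theta> + \<alpha> * L2ip S e \<theta>"
    unfolding pointwise by simp
  also have "\<dots> = - L2ip S f1 \<theta> - L2ip S f2 \<theta> - L2ip S f3 \<theta> + L2ip S f4 \<theta> + \<alpha> * L2ip S e \<theta>"
    using eq eq' unfolding G_def G'_def \<theta>_def by simp
  finally have id: "(L2norm S \<theta>u)\<^sup>2 + \<alpha> * (L2norm S \<theta>)\<^sup>2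
      = - L2ip S f1 \<theta> - L2ip S f2 \<theta> - L2ip S f3 \<theta> + L2ip S f4 \<theta> + \<alpha> * L2ip S e \<theta>"
    unfolding L2norm_power2 .
  have ip: "\<bar>L2ip S k \<theta>\<bar> \<le> N * L2norm S \<theta>" if "k \<in> L2 S" "L2norm S k \<le> N" for k N
    using L2_Cauchy_Schwarz[OF that(1) \<theta>] mult_right_mono[OF that(2) L2norm_nonneg[of S \<theta>]] by linarith
  have ipe: "\<alpha> * L2ip S e \<theta> \<le> \<alpha> * (L2norm S e * L2norm S \<theta>)"
    using ip[OF e order_refl] \<alpha> by (intro mult_left_mono) auto
  \<comment> \<open>The nonnegative term \<open>(L2norm S \<theta>u)\<^sup>2\<close> is
    dropped.\<close>
  have "\<alpha> * (L2norm S \<theta>)\<^sup>2 \<le> V * L2norm S dw * L2norm S \<theta> + E * L2norm S w * L2norm S \<theta>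
      + E * ((U + V) * L2norm S q) * L2norm S \<theta> + V * (V * L2norm S e) * L2norm S \<theta>
      + \<alpha> * (L2norm S e * L2norm S \<theta>)"
    using id ipe ip[OF f(1) nf1] ip[OF f(2) nf2] ip[OF f(3) nf3] ip[OF f(4) nf4]
      zero_le_power2[of "L2norm S \<theta>u"] by linarith
  also have "\<dots> = (V * L2norm S dw + (L2norm S w + (U + V) * L2norm S q) * E
      + (V\<^sup>2 + \<alpha>) * L2norm S e) * L2norm S \<theta>"
    by (simp add: algebra_simps power2_eq_square)
  finally have key: "(\<alpha> * L2norm S \<theta>) * L2norm S \<theta> \<le> (V * L2norm S dw
      + (L2norm S w + (U + V) * L2norm S q) * E + (V\<^sup>2 + \<alpha>) * L2norm S e) * L2norm S \<theta>"
    by (simp add: power2_eq_square mult.assoc)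
  have "\<alpha> * L2norm S \<theta> \<le> V * L2norm S dw
      + (L2norm S w + (U + V) * L2norm S q) * E + (V\<^sup>2 + \<alpha>) * L2norm S e"
  proof (cases "L2norm S \<theta> = 0")
    case True
    then show ?thesis using nn \<alpha> by (simp add: L2norm_nonneg)
  next
    case False
    then have "L2norm S \<theta> > 0" using L2norm_nonneg[of S \<theta>] by simp
    with key show ?thesis by (rule mult_right_le_imp_le)
  qed
  then show ?thesis unfolding \<theta>_def dw_def e_def .
qed

text \<open>Here \<open>g\<close> plays the interpolant of \<open>q\<close> and \<open>e\<close> the
  quantity \<open>h powr m * sobolev_norm m S q\<close>. The preceding estimate is used with
  \<open>V = 2 * U\<close>, and the triangle inequality through \<open>g\<close> adds one more
  \<open>\<alpha>\<close> times the interpolation error, hence \<open>2 * \<alpha>\<close> in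
  \<open>K\<close>.\<close>

lemma potential_reconstruction_error:
  fixes S :: "(real^'n) set" and U B \<alpha> c :: real
  defines "K \<equiv> (2 * U + (B + (U + 2 * U) * (B / sqrt \<alpha>)) + ((2 * U)\<^sup>2 + 2 * \<alpha>) * c) / \<alpha>"
  assumes nonnull: "emeasure (lebesgue_on S) (space (lebesgue_on S)) \<noteq> 0"
    and w: "w \<in> L2 S" and w': "w' \<in> L2 S" and B: "L2norm S w = B"
    and u: "u \<in> Linf S" and u': "u' \<in> Linf S" and UB: "Linf_norm S u = U"
    and \<kappa>: "\<kappa> > 0" "AE x in lebesgue_on S. \<kappa> \<le> \<bar>u x\<bar>"
    and Ele: "Linf_norm S (\<lambda>x. u' x - u x) \<le> \<kappa> / 2"
    and min: "is_arg_min (J_potential S w u \<alpha>) (\<lambda>v. v \<in> L2 S) q"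
    and min': "is_arg_min (J_potential S w' u' \<alpha>) (\<lambda>v. v \<in> dg_space r S \<T>) q'"
    and g: "g \<in> dg_space r S \<T>" and e: "L2norm S (\<lambda>x. q x - g x) \<le> c * e"
    and pos: "\<alpha> > 0" "c > 0" "e \<ge> 0"
  shows "L2norm S (\<lambda>x. q' x - q x) \<le> (1 + \<bar>K\<bar> * U\<^sup>2) / \<kappa>\<^sup>2 *
    (L2norm S (\<lambda>x. w' x - w x) + Linf_norm S (\<lambda>x. u' x - u x) + e)"
proof -
  define Ew where "Ew = L2norm S (\<lambda>x. w' x - w x)"
  define Eu where "Eu = Linf_norm S (\<lambda>x. u' x - u x)"
  have nn: "0 \<le> Ew" "0 \<le> Eu" "0 \<le> e"
    using pos by (simp_all add: Ew_def Eu_def L2norm_nonneg Linf_norm_nonneg)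
  have q: "q \<in> L2 S" and q': "q' \<in> dg_space r S \<T>"
    using min min' by (simp_all add: is_arg_min_def)
  then have L2: "q' \<in> L2 S" "g \<in> L2 S" using g by (simp_all add: dg_space_def)
  let ?\<theta> = "\<lambda>x. q' x - g x"
  have \<theta>: "?\<theta> \<in> L2 S" "?\<theta> \<in> dg_space r S \<T>"
    using L2_diff[OF L2] dg_space_add_scaled[OF q' g, of "-1"] by simp_all
  have U: "AE x in lebesgue_on S. \<bar>u x\<bar> \<le> U" using Linf_AE_bound[OF u] UB by simp
  have "(\<lambda>x. u' x - u x) \<in> Linf S" using Linf_add_scaled[OF u' u, of "-1"] by simp
  then have E: "AE x in lebesgue_on S. \<bar>u' x - u x\<bar> \<le> Eu"
    unfolding Eu_def by (rule Linf_AE_bound)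
  \<comment> \<open>Almost everywhere \<open>\<kappa> \<le> \<bar>u x\<bar> \<le> U\<close>; on a
    set of positive measure some point satisfies this.\<close>
  have \<kappa>U: "\<kappa> \<le> U"
  proof (rule ccontr)
    assume "\<not> \<kappa> \<le> U"
    have "AE x in lebesgue_on S. False"
      using U \<kappa>(2) by eventually_elim (use \<open>\<not> \<kappa> \<le> U\<close> in linarith)
    then show False using nonnull ae_filter_eq_bot_iff[of "lebesgue_on S"]
      by (simp add: eventually_False)
  qed
  have Ele': "Eu \<le> \<kappa> / 2" using Ele by (simp add: Eu_def)
  \<comment> \<open>Indeed \<open>U + \<kappa> / 2 \<le> 2 * U\<close>.\<close>
  have V: "AE x in lebesgue_on S. \<bar>u' x\<bar> \<le> 2 * U"
    using U E by eventually_elim (use Ele' \<kappa>U \<kappa>(1) in linarith)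
  have U0: "0 \<le> U" "0 \<le> 2 * U" using \<kappa>U \<kappa>(1) by simp_all
  have B0: "0 \<le> B" using B L2norm_nonneg by metis
  have qB: "L2norm S q \<le> B / sqrt \<alpha>"
    using J_potential_minimizer_bound[OF min pos(1)] B by simp
  let ?e = "L2norm S (\<lambda>x. q x - g x)"
  have "\<alpha> * L2norm S ?\<theta> \<le> 2 * U * Ew + (B + (U + 2 * U) * L2norm S q) * Eu
      + ((2 * U)\<^sup>2 + \<alpha>) * ?e"
    using potential_error[OF w w' q L2 u u' U V E U0 nn(2) pos(1)
        J_potential_normal_eq[OF min L2_add_scaled[OF q \<theta>(1)] w u q \<theta>(1)]
        J_potential_normal_eq[OF min' dg_space_add_scaled[OF q' \<theta>(2)] w' u' L2(1) \<theta>(1)]]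
    unfolding Ew_def B .
  moreover have "L2norm S (\<lambda>x. q' x - q x) \<le> L2norm S ?\<theta> + ?e"
    using L2norm_triangle[OF \<theta>(1) L2_diff[OF L2(2) q]] L2norm_minus_commute[of S g q] by simp
  then have "\<alpha> * L2norm S (\<lambda>x. q' x - q x) \<le> \<alpha> * L2norm S ?\<theta> + \<alpha> * ?e"
    using pos(1) by (simp flip: distrib_left)
  ultimately have "\<alpha> * L2norm S (\<lambda>x. q' x - q x) \<le> 2 * U * Ew
      + (B + (U + 2 * U) * L2norm S q) * Eu + ((2 * U)\<^sup>2 + 2 * \<alpha>) * ?e"
    by (simp add: algebra_simps)
  also have "\<dots> \<le> 2 * U * Ew + (B + (U + 2 * U) * (B / sqrt \<alpha>)) * Eu
      + ((2 * U)\<^sup>2 + 2 * \<alpha>) * (c * e)"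
    using qB e nn U0 pos by (intro add_mono mult_left_mono mult_right_mono order_refl) auto
  \<comment> \<open>All coefficients and errors are nonnegative, so each coefficient may be enlarged
    to their sum \<open>\<alpha> * K\<close>.\<close>
  also have "\<dots> \<le> (\<alpha> * K) * (Ew + Eu + e)"
  proof -
    define a b d where "a = 2 * U" and "b = B + (U + 2 * U) * (B / sqrt \<alpha>)"
      and "d = ((2 * U)\<^sup>2 + 2 * \<alpha>) * c"
    have abd: "0 \<le> a" "0 \<le> b" "0 \<le> d" "\<alpha> * K = a + b + d"
      using U0 B0 pos by (auto simp: a_def b_def d_def K_def)
    have "a * Ew + b * Eu + d * e \<le> (a + b + d) * (Ew + Eu + e)"
      unfolding distrib_left using nn abd by (intro add_mono mult_right_mono) auto
    then show ?thesis unfolding abd(4) by (simp add: a_def b_def d_def mult.assoc)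
  qed
  finally have "L2norm S (\<lambda>x. q' x - q x) \<le> K * (Ew + Eu + e)"
    using pos(1) by (simp add: mult.assoc)
  \<comment> \<open>The factor \<open>\<kappa>\<^sup>-\<^sup>2\<close> enters here, through
    \<open>1 \<le> U\<^sup>2 / \<kappa>\<^sup>2\<close>.\<close>
  also have "\<dots> \<le> (1 + \<bar>K\<bar> * U\<^sup>2) / \<kappa>\<^sup>2 * (Ew + Eu + e)"
  proof (rule mult_right_mono)
    have "K * \<kappa>\<^sup>2 \<le> \<bar>K\<bar> * U\<^sup>2"
      using power_mono[OF \<kappa>U, of 2] \<kappa>(1) by (intro mult_mono) auto
    then show "K \<le> (1 + \<bar>K\<bar> * U\<^sup>2) / \<kappa>\<^sup>2"
      using \<kappa>(1) by (simp add: pos_le_divide_eq)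
  qed (use nn in simp)
  finally show ?thesis unfolding Ew_def Eu_def .
qed

section \<open>Application to the reconstruction scheme\<close>

lemma sobolev_norm_nonneg: "0 \<le> sobolev_norm m S v"
  by (auto simp: sobolev_norm_def intro!: add_nonneg_nonneg sum_nonneg)

(* U and B are the values of the L-infinity norm of u_alpha and of the L2 norm of w_alpha on Omega',
   and C_I is the constant of the approximation operator I_Q. Besides these, the constant C depends
   only on alpha_q, Omega', and the fixed parameter alpha. *)
theorem theorem3p13:
  fixes \<Omega>' :: "(real^'n) set"
    and \<alpha> \<alpha>\<^sub>q U B C\<^sub>I :: real
  assumes "\<alpha> > 0" and "\<alpha>\<^sub>q > 0" and "C\<^sub>I > 0"
  shows "\<exists>C>0. \<forall>\<Omega> W c s \<epsilon> f q u \<delta> \<mu>\<delta> g\<delta> R p p\<^sub>W H \<T> \<T>\<^sub>W \<T>\<^sub>Q d\<^sub>0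
      u\<^sub>0 u\<^sub>\<alpha> w\<^sub>\<alpha> M\<^sub>w q\<^sub>\<alpha> u\<^sub>f\<^sub>h u\<^sub>0\<^sub>h u\<^sub>h w\<^sub>h q\<^sub>h \<kappa>\<^sub>0 m r I\<^sub>Q.
    continuous_setting \<Omega> \<Omega>' W c s \<epsilon> f q u \<delta> \<mu>\<delta> g\<delta> \<and>
    discrete_setting \<Omega> \<Omega>' W R p p\<^sub>W H \<T> \<T>\<^sub>W \<T>\<^sub>Q \<and>
    setdist W \<Omega> = d\<^sub>0 \<and> d\<^sub>0 > 0 \<and>
    is_arg_min (J_state c s \<Omega> W \<mu>\<delta> \<alpha>) (\<lambda>v. v \<in> Htilde s \<Omega>) u\<^sub>0 \<and>
    u\<^sub>\<alpha> = (\<lambda>x. f x + u\<^sub>0 x) \<and> u\<^sub>\<alpha> \<in> Linf \<Omega>' \<and> Linf_norm \<Omega>' u\<^sub>\<alpha> = U \<and>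
    is_fracLap c s \<Omega>' u\<^sub>\<alpha> w\<^sub>\<alpha> \<and> w\<^sub>\<alpha> \<in> L2 \<Omega>' \<and> L2norm \<Omega>' w\<^sub>\<alpha> = B \<and> L2norm \<Omega>' w\<^sub>\<alpha> \<le> M\<^sub>w \<and>
    is_arg_min (J_potential \<Omega>' w\<^sub>\<alpha> u\<^sub>\<alpha> \<alpha>\<^sub>q) (\<lambda>v. v \<in> L2 \<Omega>') q\<^sub>\<alpha> \<and>
    (\<forall>h\<in>H.
      nodal_interpolant p (cube R) (\<T> h) f (u\<^sub>f\<^sub>h h) \<and>
      is_arg_min (J_state_h c s \<Omega> W R p\<^sub>W (\<T>\<^sub>W h) g\<delta> (u\<^sub>f\<^sub>h h) \<alpha>)
        (\<lambda>v. v \<in> fe_space0 p \<Omega> (cube R) (\<T> h)) (u\<^sub>0\<^sub>h h) \<and>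
      u\<^sub>h h = (\<lambda>x. u\<^sub>f\<^sub>h h x + u\<^sub>0\<^sub>h h x) \<and>
      fracLap_rec_h c s \<Omega> R p (\<T> h) (u\<^sub>h h) (w\<^sub>h h) \<and>
      is_arg_min (J_potential \<Omega>' (w\<^sub>h h) (u\<^sub>h h) \<alpha>\<^sub>q) (\<lambda>v. v \<in> dg_space r \<Omega>' (\<T>\<^sub>Q h)) (q\<^sub>h h)) \<and>
    \<kappa>\<^sub>0 > 0 \<and> (AE x in lebesgue_on \<Omega>'. \<bar>u\<^sub>\<alpha> x\<bar> \<ge> \<kappa>\<^sub>0) \<and>
    0 < m \<and> m \<le> real r + 1 \<and> q\<^sub>\<alpha> \<in> sobolev m \<Omega>' \<and>
    (\<forall>h\<in>H. \<forall>v\<in>sobolev m \<Omega>'.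
      I\<^sub>Q h v \<in> dg_space r \<Omega>' (\<T>\<^sub>Q h) \<and>
      L2norm \<Omega>' (\<lambda>x. v x - I\<^sub>Q h v x) \<le> C\<^sub>I * h powr m * sobolev_norm m \<Omega>' v \<and>
      L2norm \<Omega>' (I\<^sub>Q h v) \<le> C\<^sub>I * L2norm \<Omega>' v)
    \<longrightarrow>
    (\<forall>h\<in>H. Linf_norm \<Omega>' (\<lambda>x. u\<^sub>h h x - u\<^sub>\<alpha> x) \<le> \<kappa>\<^sub>0 / 2 \<longrightarrow>
      L2norm \<Omega>' (\<lambda>x. q\<^sub>h h x - q\<^sub>\<alpha> x) \<le> C / \<kappa>\<^sub>0\<^sup>2 *
        (L2norm \<Omega>' (\<lambda>x. w\<^sub>h h x - w\<^sub>\<alpha> x) + Linf_norm \<Omega>' (\<lambda>x. u\<^sub>h h x - u\<^sub>\<alpha> x)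
         + h powr m * sobolev_norm m \<Omega>' q\<^sub>\<alpha>))"
proof -
  define K where "K = (2 * U + (B + (U + 2 * U) * (B / sqrt \<alpha>\<^sub>q)) + ((2 * U)\<^sup>2 + 2 * \<alpha>\<^sub>q) * C\<^sub>I) / \<alpha>\<^sub>q"
  \<comment> \<open>\<open>U\<close> and \<open>B\<close> are arbitrary reals at this stage, so
    \<open>K\<close> may be negative and \<open>U\<close> may be 0; the absolute value and the
    summand 1 keep the constant positive.\<close>
  have C_pos: "1 + \<bar>K\<bar> * U\<^sup>2 > 0"
    by (intro add_pos_nonneg) auto
  show ?thesis
  proof (intro exI[of _ "1 + \<bar>K\<bar> * U\<^sup>2"] conjI C_pos allI impI ballI, elim conjE, goal_cases)
    case prems: (1 \<Omega> W c s \<epsilon> f q u \<delta> \<mu>\<delta> g\<delta> R p p\<^sub>W H \<T> \<T>\<^sub>W \<T>\<^sub>Q d\<^sub>0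
      u\<^sub>0 u\<^sub>\<alpha> w\<^sub>\<alpha> M\<^sub>w q\<^sub>\<alpha> u\<^sub>f\<^sub>h u\<^sub>0\<^sub>h u\<^sub>h w\<^sub>h q\<^sub>h \<kappa>\<^sub>0 m r I\<^sub>Q h)
    have e0: "0 \<le> h powr m * sobolev_norm m \<Omega>' q\<^sub>\<alpha>"
      by (simp add: sobolev_norm_nonneg)
    show ?case
    \<comment> \<open>On a null set \<open>\<kappa>\<^sub>0 \<le> U\<close> can fail, but there the
      left-hand side is 0.\<close>
    proof (cases "emeasure (lebesgue_on \<Omega>') (space (lebesgue_on \<Omega>')) = 0")
      case True
      have "0 \<le> (1 + \<bar>K\<bar> * U\<^sup>2) / \<kappa>\<^sub>0\<^sup>2 * (L2norm \<Omega>' (\<lambda>x. w\<^sub>h h x - w\<^sub>\<alpha> x)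
          + Linf_norm \<Omega>' (\<lambda>x. u\<^sub>h h x - u\<^sub>\<alpha> x) + h powr m * sobolev_norm m \<Omega>' q\<^sub>\<alpha>)"
        using C_pos e0
        by (intro mult_nonneg_nonneg[OF divide_nonneg_nonneg] add_nonneg_nonneg L2norm_nonneg Linf_norm_nonneg)
          (auto simp: sobolev_norm_nonneg)
      then show ?thesis unfolding L2norm_eq_0_if_null[OF True, of "\<lambda>x. q\<^sub>h h x - q\<^sub>\<alpha> x"] .
    next
      case False
      \<comment> \<open>\<open>\<Omega>'\<close> lies in the cube, on whose closure finite element
        functions are continuous, hence bounded.\<close>
      have "closure \<Omega>' \<subseteq> \<Omega>" "compact (closure \<Omega>')" and open_\<Omega>': "open \<Omega>'"
        using prems(3) by (simp_all add: continuous_setting_def compactly_in_def)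
      moreover have "\<Omega> \<subseteq> cube R" using prems(4) by (simp add: discrete_setting_def)
      ultimately have sub: "\<Omega>' \<subseteq> cube R" and bdd: "bounded \<Omega>'"
        using closure_subset[of \<Omega>'] by (auto dest!: compact_imp_bounded intro: bounded_subset)
      have "bounded (cube R :: (real^'n) set)" by (simp add: cube_def)
      note Linf = fe_space_imp_Linf[OF _ this open_\<Omega>' sub]
      note disc = prems(16)[THEN bspec, OF prems(1)]
      have fe: "u\<^sub>f\<^sub>h h \<in> fe_space p (cube R) (\<T> h)" "u\<^sub>0\<^sub>h h \<in> fe_space p (cube R) (\<T> h)"
        "w\<^sub>h h \<in> fe_space p (cube R) (\<T> h)"
        using disc by (simp_all add: nodal_interpolant_def is_arg_min_def fracLap_rec_h_def fe_space0_def)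
      have "u\<^sub>h h = (\<lambda>x. u\<^sub>f\<^sub>h h x + 1 * u\<^sub>0\<^sub>h h x)" using disc by simp
      then have u\<^sub>h: "u\<^sub>h h \<in> Linf \<Omega>'"
        using Linf_add_scaled[OF Linf[OF fe(1)] Linf[OF fe(2)], of 1] by (simp only:)
      have w\<^sub>h: "w\<^sub>h h \<in> L2 \<Omega>'"
        by (rule Linf_imp_L2[OF Linf[OF fe(3)] open_\<Omega>' bdd])
      have min_h: "is_arg_min (J_potential \<Omega>' (w\<^sub>h h) (u\<^sub>h h) \<alpha>\<^sub>q)
          (\<lambda>v. v \<in> dg_space r \<Omega>' (\<T>\<^sub>Q h)) (q\<^sub>h h)"
        using disc by (elim conjE)
      \<comment> \<open>The approximation property of \<open>I\<^sub>Q\<close> is applied to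
        \<open>q\<^sub>\<alpha>\<close>, so \<open>I\<^sub>Q h q\<^sub>\<alpha>\<close> serves as
        \<open>g\<close>; reassociating the product isolates \<open>C\<^sub>I\<close> as the factor
        \<open>c\<close>.\<close>
      note I = prems(22)[THEN bspec, OF prems(1), THEN bspec, OF prems(21)]
      show ?thesis unfolding K_def
        by (rule potential_reconstruction_error[OF False prems(12) w\<^sub>h prems(13) prems(9) u\<^sub>h prems(10)
              prems(17,18) prems(2) prems(15) min_h I[THEN conjunct1]
              I[THEN conjunct2, THEN conjunct1, unfolded mult.assoc] assms(2,3) e0])
    qed
  qed
qed

end
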